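(* For $a_j,b_j\in(0,\infty)$, $j=0,1,2$, let $a(x)=a_0(x+a_1)(x+a_2)$ and $b(x)=b_0(x+b_1)(x+b_2)$, $x\in\mathbb{R}_+$, with $a_1\le a_2$ and $b_1\le b_2$. Then: (i) $\big\{\frac{1}{b(m)+a(m)n}\big\}_{m,n\in\mathbb{Z}_+}$ is a minimal joint completely monotone net provided $$(b_1\le a_1\le b_2\ \text{ or }\ b_1\le a_2\le b_2)\ \text{ and }\ b_1+b_2\le a_1+a_2;$$ (ii) if $\big\{\frac{1}{b(m)+a(m)n}\big\}_{m,n\in\mathbb{Z}_+}$ is joint completely monotone, then $$\frac1{a_1}+\frac1{a_2}\le\frac1{b_1}+\frac1{b_2},\qquad b_1+b_2\le a_1+a_2.$$
   Context: $\mathbb{Z}_+$ is the set of nonnegative integers and $\mathbb{R}_+$ the set of nonnegative reals. For a real sequence $\{u_k\}_{k\in\mathbb{Z}_+}$ put $\triangle u_k=u_{k+1}-u_k$; the sequence is completely monotone if $(-1)^j\triangle^j u_k\ge 0$ for all $j,k\in\mathbb{Z}_+$. For a real net $\{u_{m,n}\}_{m,n\in\mathbb{Z}_+}$ put $\triangle_1u_{m,n}=u_{m+1,n}-u_{m,n}$ and $\triangle_2u_{m,n}=u_{m,n+1}-u_{m,n}$. The net is joint completely monotone if $(-1)^{i+j}\triangle_1^i\triangle_2^j u_{m,n}\ge 0$ for all $i,j,m,n\in\mathbb{Z}_+$. A joint completely monotone net is minimal if for every $\epsilon>0$ neither of the sequences $\{u_{k,0}-\epsilon\mathbf{1}_{\{0\}}(k)\}_k$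 and $\{u_{0,k}-\epsilon\mathbf{1}_{\{0\}}(k)\}_k$ is completely monotone, where $\mathbf{1}_{\{0\}}$ is the indicator function of $\{0\}$. *)

theory Defs
  imports Complex_Main "HOL-Library.Indicator_Function"
begin

definition diff_seq :: "(nat \<Rightarrow> real) \<Rightarrow> nat \<Rightarrow> real" where
  "diff_seq u k = u (k + 1) - u k"

definition completely_monotone :: "(nat \<Rightarrow> real) \<Rightarrow> bool" where
  "completely_monotone u \<longleftrightarrow> (\<forall>j k. (-1) ^ j * (diff_seq ^^ j) u k \<ge> 0)"

definition diff_net1 :: "(nat \<Rightarrow> nat \<Rightarrow> real) \<Rightarrow> nat \<Rightarrow> nat \<Rightarrow> real" where
  "diff_net1 u m n = u (m + 1) n - u m n"

definition diff_net2 :: "(nat \<Rightarrow> nat \<Rightarrow> real) \<Rightarrow> nat \<Rightarrow> nat \<Rightarrow> real" where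
  "diff_net2 u m n = u m (n + 1) - u m n"

definition joint_completely_monotone :: "(nat \<Rightarrow> nat \<Rightarrow> real) \<Rightarrow> bool" where
  "joint_completely_monotone u \<longleftrightarrow>
     (\<forall>i j m n. (-1) ^ (i + j) * (diff_net1 ^^ i) ((diff_net2 ^^ j) u) m n \<ge> 0)"

definition minimal_joint_completely_monotone :: "(nat \<Rightarrow> nat \<Rightarrow> real) \<Rightarrow> bool" where
  "minimal_joint_completely_monotone u \<longleftrightarrow>
     joint_completely_monotone u \<and>
     (\<forall>\<epsilon>>0. \<not> completely_monotone (\<lambda>k. u k 0 - \<epsilon> * indicator {0} k) \<and>
            \<not> completely_monotone (\<lambda>k. u 0 k - \<epsilon> * indicator {0} k))"

end

theory Submission
  imports Defs "HOL-Analysis.Harmonic_Numbers" "HOL-Analysis.Infinite_Products"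
begin

text \<open>
  With r = b0/a0 write b/a = r (1 - h), where h is a combination of 1/(x+a2) and
  1/((x+a1)(x+a2)) with coefficients \<open>\<sigma>\<close> = a1+a2-b1-b2 and \<open>\<tau>\<close> = (a1-b1)(b2-a1). The differences
  of the net in n are, up to sign and a factorial, \<open>1/a(m) \<cdot> \<Prod> 1/(b(m)/a(m) + l)\<close> over a block of
  consecutive l. Under the hypothesis of (i) both coefficients are nonnegative, so h is completely
  monotone in m; hence so is 1/(l + r - r h), by expanding it as a geometric series, and products
  of completely monotone sequences are completely monotone.

  For (ii), the differences of these products in m only see integers, but Newton's series
  at 0, 1, 2, ... recovers a product F at a point -x in (-a1, 0) and, all its terms being
  nonnegative, gives \<open>F(-x) \<ge> F(0)\<close>. Letting the block of l grow, the divergence of the harmonic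
  series turns this into \<open>b(-x)/a(-x) \<le> b(0)/a(0)\<close>, and x \<open>\<rightarrow>\<close> 0 yields the inequality between the
  reciprocals. In the same way b(m)/a(m) increases in m; comparing with its limit r yields
  the inequality between the sums. The remainder of the Newton series is controlled by dominating
  F by a multiple of 1/(x+c), whose divided differences are explicit.
\<close>

section \<open>Divided differences over increasing nodes\<close>

locale nodes =
  fixes p :: "nat \<Rightarrow> real"
  assumes strict_mono_p: "strict_mono p"
begin

text \<open>Divided differences on the nodes \<open>p i, \<dots>, p (i + k)\<close>, normalised by the sign \<open>(-1)^k\<close>.\<close>

primrec dd :: "nat \<Rightarrow> (nat \<Rightarrow> real) \<Rightarrow> nat \<Rightarrow> real" where
  "dd 0 v i = v i"
| "dd (Suc k) v i = (dd k v i - dd k v (Suc i)) / (p (i + Suc k) - p i)"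

definition cm :: "(nat \<Rightarrow> real) \<Rightarrow> bool" where
  "cm v \<longleftrightarrow> (\<forall>k i. 0 \<le> dd k v i)"

text \<open>The bounds -V \<le> v \<le> V in the order with positive cone \<open>cm\<close>. It
  replaces absolute values when h has coefficients of either sign.\<close>

definition dom :: "(nat \<Rightarrow> real) \<Rightarrow> (nat \<Rightarrow> real) \<Rightarrow> bool" where
  "dom v V \<longleftrightarrow> cm (\<lambda>i. V i + v i) \<and> cm (\<lambda>i. V i - v i)"

text \<open>
  Multiplication by V is bounded by K relative to the weight 1/(y+c) in the order induced
  by \<open>cm\<close>. Unlike \<open>dom\<close>, this forgets the factors of a product one at a time.
\<close>

definition wbound :: "real \<Rightarrow> real \<Rightarrow> (nat \<Rightarrow> real) \<Rightarrow> bool" where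
  "wbound c K V \<longleftrightarrow> 0 \<le> K \<and> cm V \<and> cm (\<lambda>i. (K - V i) * (1 / (p i + c)))"

lemma p_less: "0 < k \<Longrightarrow> p i < p (i + k)"
  using strict_mono_p by (simp add: strict_mono_def)

lemma dd_step: "dd k v i - dd k v (Suc i) = (p (i + Suc k) - p i) * dd (Suc k) v i"
  using p_less[of "Suc k" i] by simp

lemma dd_add: "dd k (\<lambda>i. u i + v i) i = dd k u i + dd k v i"
  by (induction k arbitrary: i) (simp_all add: add_divide_distrib [symmetric] algebra_simps)

lemma dd_cmult: "dd k (\<lambda>i. c * v i) i = c * dd k v i"
  by (induction k arbitrary: i) (simp_all add: right_diff_distrib [symmetric])

lemma dd_diff: "dd k (\<lambda>i. u i - v i) i = dd k u i - dd k v i"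
  using dd_add[of k u "\<lambda>i. (-1) * v i" i] dd_cmult[of k "-1" v i] by simp

text \<open>Leibniz rule. The normalising signs (-1)^k and (-1)^(n-k) multiply to (-1)^n, so no sign
  is left and products preserve \<open>cm\<close>.\<close>

lemma dd_mult: "dd n (\<lambda>i. u i * v i) i = (\<Sum>k\<le>n. dd k u i * dd (n - k) v (i + k))"
proof (induction n arbitrary: i)
  case (Suc n)
  let ?d = "p (i + Suc n) - p i"
  let ?W = "\<lambda>k. dd k u i * dd (Suc n - k) v (i + k)"
  have "dd n (\<lambda>i. u i * v i) i - dd n (\<lambda>i. u i * v i) (Suc i) =
     (\<Sum>k\<le>n. dd k u i * dd (n - k) v (i + k) - dd k u (Suc i) * dd (n - k) v (Suc i + k))"
    unfolding Suc.IH sum_subtractf by simp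
  also have "\<dots> = (\<Sum>k\<le>n. (p (i + Suc n) - p (i + k)) * ?W k + (p (i + Suc k) - p i) * ?W (Suc k))"
  proof (rule sum.cong, simp)
    fix k assume "k \<in> {..n}"
    then have k: "k \<le> n" by simp
    have 1: "dd (n - k) v (i + k) - dd (n - k) v (Suc i + k)
        = (p (i + Suc n) - p (i + k)) * dd (Suc n - k) v (i + k)"
      using dd_step[of "n - k" v "i + k"] k by (simp add: Suc_diff_le del: dd.simps)
    have 2: "dd k u i - dd k u (Suc i) = (p (i + Suc k) - p i) * dd (Suc k) u i"
      by (rule dd_step)
    have "dd k u i * dd (n - k) v (i + k) - dd k u (Suc i) * dd (n - k) v (Suc i + k)
      = dd k u i * (dd (n - k) v (i + k) - dd (n - k) v (Suc i + k))
        + (dd k u i - dd k u (Suc i)) * dd (n - k) v (Suc i + k)"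
      by (simp add: algebra_simps)
    then show "dd k u i * dd (n - k) v (i + k) - dd k u (Suc i) * dd (n - k) v (Suc i + k)
      = (p (i + Suc n) - p (i + k)) * ?W k + (p (i + Suc k) - p i) * ?W (Suc k)"
      unfolding 1 2 by (simp del: dd.simps)
  qed
  \<comment> \<open>Both sums extend freely: the first gains a zero coefficient at k =
    \<open>Suc n\<close>, the shifted second one at k = 0. The coefficients then add up to the total
    gap \<open>?d\<close>.\<close>
  also have "\<dots> = (\<Sum>k\<le>Suc n. (p (i + Suc n) - p (i + k)) * ?W k)
      + (\<Sum>k\<le>Suc n. (p (i + k) - p i) * ?W k)"
    by (subst (2) sum.atMost_Suc_shift) (simp add: sum.distrib del: dd.simps)
  also have "\<dots> = ?d * (\<Sum>k\<le>Suc n. ?W k)"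
    unfolding sum.distrib [symmetric] sum_distrib_left
    by (rule sum.cong) (simp_all add: algebra_simps del: dd.simps)
  finally show ?case
    using p_less[of "Suc n" i] by (subst dd.simps(2)) (simp add: nonzero_divide_eq_eq del: sum.atMost_Suc dd.simps)
qed simp

text \<open>The two products share all inner factors; the difference of their reciprocals leaves the
  gap of the outer nodes in the numerator, which cancels the denominator.\<close>

lemma dd_inverse:
  assumes "\<And>i. 0 < p i + c"
  shows "dd k (\<lambda>i. 1 / (p i + c)) i = 1 / (\<Prod>l\<le>k. p (i + l) + c)"
proof (induction k arbitrary: i)
  case (Suc k)
  let ?P = "\<Prod>l<k. p (Suc i + l) + c"
  have P: "?P > 0" by (intro prod_pos) (use assms in auto)
  have 1: "(\<Prod>l\<le>k. p (i + l) + c) = (p i + c) * ?P"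
    by (simp add: prod.lessThan_Suc_shift flip: lessThan_Suc_atMost del: prod.lessThan_Suc)
  have 2: "(\<Prod>l\<le>k. p (Suc i + l) + c) = ?P * (p (i + Suc k) + c)"
    by (simp flip: lessThan_Suc_atMost)
  have 3: "(\<Prod>l\<le>Suc k. p (i + l) + c) = (p i + c) * ?P * (p (i + Suc k) + c)"
    using 1 by simp
  have a: "p i + c > 0" "p (i + Suc k) + c > 0" by (rule assms)+
  have "p (i + Suc k) - p i > 0" using p_less[of "Suc k" i] by simp
  then show ?case
    unfolding dd.simps Suc.IH 1 2 3 using a P by (simp add: divide_simps)
qed simp

section \<open>Closure properties of completely monotone sequences\<close>

lemma cm_nonneg: "cm v \<Longrightarrow> 0 \<le> v i"
  unfolding cm_def by (metis dd.simps(1))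

lemma cm_add: "cm u \<Longrightarrow> cm v \<Longrightarrow> cm (\<lambda>i. u i + v i)"
  by (simp add: cm_def dd_add)

lemma cm_cmult: "0 \<le> c \<Longrightarrow> cm v \<Longrightarrow> cm (\<lambda>i. c * v i)"
  by (simp add: cm_def dd_cmult)

lemma cm_mult: "cm u \<Longrightarrow> cm v \<Longrightarrow> cm (\<lambda>i. u i * v i)"
  by (simp add: cm_def dd_mult sum_nonneg)

lemma cm_const: "0 \<le> c \<Longrightarrow> cm (\<lambda>i. c)"
proof -
  assume "0 \<le> c"
  moreover have "dd k (\<lambda>i. c) i = (if k = 0 then c else 0)" for k i
    by (induction k arbitrary: i) auto
  ultimately show ?thesis by (simp add: cm_def)
qed

lemma cm_prod: "finite A \<Longrightarrow> (\<And>l. l \<in> A \<Longrightarrow> cm (f l)) \<Longrightarrow> cm (\<lambda>i. \<Prod>l\<in>A. f l i)"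
proof (induction A rule: finite_induct)
  case empty
  show ?case using cm_const[of 1] by simp
next
  case (insert x A)
  have "cm (f x)" by (rule insert.prems) simp
  from cm_mult[OF this insert.IH[OF insert.prems]] show ?case
    by (simp only: prod.insert[OF insert.hyps] insertI2)
qed

lemma cm_inverse: "(\<And>i. 0 < p i + c) \<Longrightarrow> cm (\<lambda>i. 1 / (p i + c))"
  unfolding cm_def by (simp add: dd_inverse prod_nonneg less_imp_le)

lemma dd_tendsto:
  assumes "\<And>i. (\<lambda>n. f n i) \<longlonglongrightarrow> v i"
  shows "(\<lambda>n. dd k (f n) i) \<longlonglongrightarrow> dd k v i"
proof (induction k arbitrary: i)
  case (Suc k)
  then show ?case using p_less[of "Suc k" i] by (auto intro!: tendsto_intros)
qed (simp add: assms)

lemma cm_limit: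
  assumes "\<And>i. (\<lambda>n. f n i) \<longlonglongrightarrow> v i" "\<And>n. cm (f n)"
  shows "cm v"
  unfolding cm_def
  using LIMSEQ_le_const[OF dd_tendsto[OF assms(1)]] assms(2) by (auto simp: cm_def)

section \<open>Domination\<close>

lemma dom_cm: "dom v V \<Longrightarrow> cm V"
  unfolding dom_def using cm_cmult[of "1/2" "\<lambda>i. (V i + v i) + (V i - v i)"] cm_add by fastforce

lemma dom_self: "cm v \<Longrightarrow> dom v v"
  unfolding dom_def using cm_add[of v v] cm_const[of 0] by simp

lemma dom_dd: "dom v V \<Longrightarrow> \<bar>dd k v i\<bar> \<le> dd k V i"
proof -
  assume "dom v V"
  then have "0 \<le> dd k V i + dd k v i" "0 \<le> dd k V i - dd k v i"
    unfolding dom_def cm_def dd_add dd_diff by auto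
  then show ?thesis by linarith
qed

lemma dom_abs: "dom v V \<Longrightarrow> \<bar>v i\<bar> \<le> V i"
  using dom_dd[of v V 0 i] by simp

lemma dom_add: "dom u U \<Longrightarrow> dom v V \<Longrightarrow> dom (\<lambda>i. u i + v i) (\<lambda>i. U i + V i)"
  unfolding dom_def
  using cm_add[of "\<lambda>i. U i + u i" "\<lambda>i. V i + v i"] cm_add[of "\<lambda>i. U i - u i" "\<lambda>i. V i - v i"]
  by (simp add: algebra_simps)

text \<open>UV + uv and UV - uv are half sums of products of the \<open>cm\<close> sequences U + u,
  U - u, V + v, V - v.\<close>

lemma dom_mult:
  assumes "dom u U" "dom v V"
  shows "dom (\<lambda>i. u i * v i) (\<lambda>i. U i * V i)"
proof -
  have c: "cm (\<lambda>i. U i + u i)" "cm (\<lambda>i. U i - u i)" "cm (\<lambda>i. V i + v i)" "cm (\<lambda>i. V i - v i)"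
    using assms by (auto simp: dom_def)
  have "cm (\<lambda>i. 1/2 * ((U i + u i) * (V i + v i) + (U i - u i) * (V i - v i)))"
    by (rule cm_cmult[OF _ cm_add[OF cm_mult[OF c(1,3)] cm_mult[OF c(2,4)]]]) simp
  moreover have "cm (\<lambda>i. 1/2 * ((U i + u i) * (V i - v i) + (U i - u i) * (V i + v i)))"
    by (rule cm_cmult[OF _ cm_add[OF cm_mult[OF c(1,4)] cm_mult[OF c(2,3)]]]) simp
  moreover have "1/2 * ((U i + u i) * (V i + v i) + (U i - u i) * (V i - v i)) = U i * V i + u i * v i"
    "1/2 * ((U i + u i) * (V i - v i) + (U i - u i) * (V i + v i)) = U i * V i - u i * v i" for i
    by (simp_all add: field_simps)
  ultimately show ?thesis by (simp only: dom_def)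
qed

lemma dom_cmult: "dom v V \<Longrightarrow> dom (\<lambda>i. c * v i) (\<lambda>i. \<bar>c\<bar> * V i)"
proof -
  assume v: "dom v V"
  have "dom (\<lambda>i. c) (\<lambda>i. \<bar>c\<bar>)" unfolding dom_def by (auto intro!: cm_const)
  from dom_mult[OF this v] show ?thesis .
qed

lemma dom_prod:
  "finite A \<Longrightarrow> (\<And>l. l \<in> A \<Longrightarrow> dom (f l) (F l)) \<Longrightarrow> dom (\<lambda>i. \<Prod>l\<in>A. f l i) (\<lambda>i. \<Prod>l\<in>A. F l i)"
proof (induction A rule: finite_induct)
  case empty
  show ?case using dom_self[OF cm_const[of 1]] by simp
next
  case (insert x A)
  have "dom (f x) (F x)" by (rule insert.prems) simp
  from dom_mult[OF this insert.IH[OF insert.prems]] show ?case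
    by (simp only: prod.insert[OF insert.hyps] insertI2)
qed

lemma dom_power:
  assumes "dom v V"
  shows "dom (\<lambda>i. v i ^ n) (\<lambda>i. V i ^ n)"
proof (induction n)
  case 0
  show ?case using dom_self[OF cm_const[of 1]] by simp
next
  case (Suc n)
  show ?case using dom_mult[OF assms Suc.IH] by simp
qed

lemma dom_sum:
  "finite A \<Longrightarrow> (\<And>l. l \<in> A \<Longrightarrow> dom (f l) (F l)) \<Longrightarrow> dom (\<lambda>i. \<Sum>l\<in>A. f l i) (\<lambda>i. \<Sum>l\<in>A. F l i)"
proof (induction A rule: finite_induct)
  case empty
  show ?case using dom_self[OF cm_const[of 0]] by simp
next
  case (insert x A)
  have "dom (f x) (F x)" by (rule insert.prems) simp
  from dom_add[OF this insert.IH[OF insert.prems]] show ?case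
    by (simp only: sum.insert[OF insert.hyps] insertI2)
qed

text \<open>Partial sums of the geometric series are dominated termwise. Both series converge
  because |h| \<le> H < L, and domination survives pointwise limits.\<close>

lemma dom_geometric:
  assumes "dom h H" "\<And>i. H i < L" "0 < L"
  shows "dom (\<lambda>i. 1 / (L - h i)) (\<lambda>i. 1 / (L - H i))"
proof -
  have *: "(\<lambda>n. \<Sum>k<n. 1 / L * (1 / L * h i) ^ k) \<longlonglongrightarrow> 1 / (L - h i)" if "\<bar>h i\<bar> < L" for h :: "nat \<Rightarrow> real" and i
  proof -
    have "norm (1 / L * h i) < 1" using that assms(3) by (simp add: abs_mult)
    from sums_mult[OF geometric_sums[OF this], of "1 / L"]
    have "(\<lambda>k. 1 / L * (1 / L * h i) ^ k) sums (1 / L * (1 / (1 - 1 / L * h i)))" .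
    moreover have "1 / L * (1 / (1 - 1 / L * h i)) = 1 / (L - h i)"
      using that assms(3) by (simp add: field_simps)
    ultimately show ?thesis by (simp add: sums_def)
  qed
  have h: "\<bar>h i\<bar> < L" "\<bar>H i\<bar> < L" for i
    using dom_abs[OF assms(1), of i] assms(2)[of i] by auto
  have "dom (\<lambda>i. \<Sum>k<n. 1 / L * (1 / L * h i) ^ k) (\<lambda>i. \<Sum>k<n. \<bar>1 / L\<bar> * (\<bar>1 / L\<bar> * H i) ^ k)" for n
    using assms(1) by (intro dom_sum dom_cmult dom_power) auto
  then have D: "dom (\<lambda>i. \<Sum>k<n. 1 / L * (1 / L * h i) ^ k) (\<lambda>i. \<Sum>k<n. 1 / L * (1 / L * H i) ^ k)" for n
    using assms(3) by simp
  show ?thesis unfolding dom_def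
  proof (intro conjI; rule cm_limit)
    fix i show "(\<lambda>n. (\<Sum>k<n. 1 / L * (1 / L * H i) ^ k) + (\<Sum>k<n. 1 / L * (1 / L * h i) ^ k)) \<longlonglongrightarrow> 1 / (L - H i) + 1 / (L - h i)"
      by (intro tendsto_add * h)
    show "(\<lambda>n. (\<Sum>k<n. 1 / L * (1 / L * H i) ^ k) - (\<Sum>k<n. 1 / L * (1 / L * h i) ^ k)) \<longlonglongrightarrow> 1 / (L - H i) - 1 / (L - h i)"
      by (intro tendsto_diff * h)
  next
    fix n 
    show "cm (\<lambda>i. (\<Sum>k<n. 1 / L * (1 / L * H i) ^ k) + (\<Sum>k<n. 1 / L * (1 / L * h i) ^ k))"
     "cm (\<lambda>i. (\<Sum>k<n. 1 / L * (1 / L * H i) ^ k) - (\<Sum>k<n. 1 / L * (1 / L * h i) ^ k))"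
      using D[of n] unfolding dom_def by auto
  qed
qed

section \<open>Bounds relative to the weight 1/(y+c)\<close>

lemma wboundD:
  assumes "wbound c K V"
  shows "0 \<le> K" "cm V" "cm (\<lambda>i. (K - V i) * (1 / (p i + c)))"
  using assms by (simp_all only: wbound_def)

lemma wbound_le:
  assumes "wbound c K V" "\<And>i. 0 < p i + c"
  shows "V i \<le> K"
  using cm_nonneg[of "\<lambda>i. (K - V i) * (1 / (p i + c))" i] assms(1) assms(2)[of i]
  by (simp add: wbound_def zero_le_mult_iff zero_le_divide_iff)

text \<open>Since 1/(a-c) - 1/(y+a) = (y+c) / ((a-c)(y+a)), the weight cancels y+c.\<close>

lemma wbound_inverse:
  assumes "\<And>i. 0 < p i + c" "c < a"
  shows "wbound c (1 / (a - c)) (\<lambda>i. 1 / (p i + a))"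
proof -
  have a: "0 < p i + a" for i using assms(1)[of i] assms(2) by simp
  have "(1 / (a - c) - 1 / (p i + a)) * (1 / (p i + c)) = 1 / (a - c) * (1 / (p i + a))" for i
    using a[of i] assms(1)[of i] assms(2) by (simp add: divide_simps)
  then show ?thesis
    unfolding wbound_def using cm_inverse[OF a] assms(2) by (auto simp only: intro!: cm_cmult) simp_all
qed

lemma wbound_add:
  assumes "wbound c K V" "wbound c L U"
  shows "wbound c (K + L) (\<lambda>i. V i + U i)"
proof -
  have "cm (\<lambda>i. (K - V i) * (1 / (p i + c)) + (L - U i) * (1 / (p i + c)))"
    by (rule cm_add[OF wboundD(3)[OF assms(1)] wboundD(3)[OF assms(2)]])
  moreover have "(\<lambda>i. (K - V i) * (1 / (p i + c)) + (L - U i) * (1 / (p i + c))) =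
    (\<lambda>i. ((K + L) - (V i + U i)) * (1 / (p i + c)))"
    by (simp add: fun_eq_iff add_divide_distrib diff_divide_distrib)
  ultimately show ?thesis using assms unfolding wbound_def by (auto intro: cm_add)
qed

text \<open>K L - V U = L (K - V) + V (L - U).\<close>

lemma wbound_mult:
  assumes "wbound c K V" "wbound c L U"
  shows "wbound c (K * L) (\<lambda>i. V i * U i)"
proof -
  have "cm (\<lambda>i. L * ((K - V i) * (1 / (p i + c))) + V i * ((L - U i) * (1 / (p i + c))))"
    by (rule cm_add[OF cm_cmult[OF wboundD(1)[OF assms(2)] wboundD(3)[OF assms(1)]]
        cm_mult[OF wboundD(2)[OF assms(1)] wboundD(3)[OF assms(2)]]])
  moreover have "(\<lambda>i. L * ((K - V i) * (1 / (p i + c))) + V i * ((L - U i) * (1 / (p i + c)))) =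
    (\<lambda>i. (K * L - V i * U i) * (1 / (p i + c)))"
    by (rule ext) (simp add: diff_divide_distrib algebra_simps)
  ultimately show ?thesis using assms unfolding wbound_def by (auto intro: cm_mult)
qed

lemma wbound_const: "0 \<le> K \<Longrightarrow> wbound c K (\<lambda>i. K)"
  using cm_const[of 0] cm_const[of K] by (simp add: wbound_def)

lemma wbound_prod:
  "finite A \<Longrightarrow> (\<And>l. l \<in> A \<Longrightarrow> wbound c (K l) (f l)) \<Longrightarrow> wbound c (\<Prod>l\<in>A. K l) (\<lambda>i. \<Prod>l\<in>A. f l i)"
proof (induction A rule: finite_induct)
  case empty
  show ?case using wbound_const[of 1] by simp
next
  case (insert x A)
  have "wbound c (K x) (f x)" by (rule insert.prems) simp
  from wbound_mult[OF this insert.IH[OF insert.prems]] show ?case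
    by (simp only: prod.insert[OF insert.hyps] insertI2)
qed

text \<open>1/(L-K) - 1/(L-H) = (K-H) / ((L-K)(L-H)), a product of \<open>cm\<close> factors once
  weighted.\<close>

lemma wbound_geometric:
  assumes H: "wbound c K H" and "K < L" and c: "\<And>i. 0 < p i + c"
  shows "wbound c (1 / (L - K)) (\<lambda>i. 1 / (L - H i))"
proof -
  have le: "H i \<le> K" for i by (rule wbound_le[OF H c])
  have L: "H i < L" for i using le[of i] assms(2) by linarith
  have "0 \<le> K" using H by (simp add: wbound_def)
  then have "0 < L" using assms(2) by simp
  have cm: "cm (\<lambda>i. 1 / (L - H i))"
    by (rule dom_cm, rule dom_geometric[OF dom_self[OF wboundD(2)[OF H]]]) (use L \<open>0 < L\<close> in auto)
  have "cm (\<lambda>i. (1 / (L - K)) * (((K - H i) * (1 / (p i + c))) * (1 / (L - H i))))"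
    by (rule cm_cmult[OF _ cm_mult[OF wboundD(3)[OF H] cm]]) (use assms(2) in simp)
  moreover have "(1 / (L - K)) * (((K - H i) * (1 / (p i + c))) * (1 / (L - H i))) =
    (1 / (L - K) - 1 / (L - H i)) * (1 / (p i + c))" for i
    using L[of i] assms(2) c[of i] by (simp add: divide_simps)
  ultimately show ?thesis using cm assms(2) unfolding wbound_def by simp
qed

text \<open>Newton interpolation at \<open>p 1\<close>, \<open>p 2\<close>, ..., evaluated at
  \<open>p 0\<close>, with remainder. As \<open>p 0\<close> is the least node, the positive factors
  \<open>p (Suc l) - p 0\<close> absorb all signs.\<close>

lemma newton:
  "v 0 = (\<Sum>k\<le>N. (\<Prod>l<k. p (Suc l) - p 0) * dd k v 1) + (\<Prod>l\<le>N. p (Suc l) - p 0) * dd (Suc N) v 0"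
proof (induction N)
  case 0
  show ?case using dd_step[of 0 v 0] by simp
next
  case (Suc N)
  have "dd (Suc N) v 0 = dd (Suc N) v 1 + (p (Suc (Suc N)) - p 0) * dd (Suc (Suc N)) v 0"
    using dd_step[of "Suc N" v 0] by simp
  from arg_cong[OF this, of "(*) (\<Prod>l\<le>N. p (Suc l) - p 0)"] show ?case
    using Suc.IH by (simp add: lessThan_Suc_atMost ring_distribs mult.assoc del: dd.simps)
qed

text \<open>Exchanges one factor 1/(y+a) for the weight, at the cost of (a-c) / ((y+c)(y+a)). This
  gives the explicit majorant K/(y+c).\<close>

lemma wbound_mult_inverse:
  assumes V: "wbound c K V" and c: "\<And>i. 0 < p i + c" and "c < a"
  shows "cm (\<lambda>i. K * (1 / (p i + c)) - V i * (1 / (p i + a)))"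
proof -
  have a: "0 < p i + a" for i using c[of i] assms(3) by simp
  have "cm (\<lambda>i. (K - V i) * (1 / (p i + c)) + (a - c) * (V i * ((1 / (p i + c)) * (1 / (p i + a)))))"
    by (rule cm_add[OF wboundD(3)[OF V] cm_cmult[OF _
        cm_mult[OF wboundD(2)[OF V] cm_mult[OF cm_inverse[OF c] cm_inverse[OF a]]]]])
      (use assms(3) in simp)
  moreover have "(K - V i) * (1 / (p i + c)) + (a - c) * (V i * ((1 / (p i + c)) * (1 / (p i + a))))
      = K * (1 / (p i + c)) - V i * (1 / (p i + a))" for i
    using a[of i] c[of i] by (simp add: divide_simps) (simp add: algebra_simps)
  ultimately show ?thesis by simp
qed

end

section \<open>Products of ratios and the harmonic series\<close>

lemma prod_ratio_tendsto_0:
  fixes s t :: real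
  assumes "0 < s" "s < t"
  shows "(\<lambda>N. \<Prod>l\<le>N. (s + real l) / (t + real l)) \<longlonglongrightarrow> 0"
proof -
  \<comment> \<open>The reciprocal product has factors 1 + (t-s)/(s+l), so it is at least the sum of
    the (t-s)/(s+l), hence at least a multiple of a harmonic sum.\<close>
  have ge: "(t - s) / (s + 1) * harm (Suc N) \<le> (\<Prod>l\<le>N. (t + real l) / (s + real l))" for N
  proof -
    have "harm (Suc N) = (\<Sum>l\<le>N. 1 / (real l + 1))"
      by (induction N) (simp_all add: harm_Suc harm_def inverse_eq_divide add_ac)
    then have "(t - s) / (s + 1) * harm (Suc N) = (\<Sum>l\<le>N. (t - s) / (s + 1) * (1 / (real l + 1)))"
      by (simp only: sum_distrib_left)
    also have "\<dots> \<le> (\<Sum>l\<le>N. (t - s) / (s + real l))"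
    proof (rule sum_mono)
      fix l
      have "s + real l \<le> (s + 1) * (real l + 1)"
        using assms by (simp add: algebra_simps)
      then show "(t - s) / (s + 1) * (1 / (real l + 1)) \<le> (t - s) / (s + real l)"
        using assms by (simp add: frac_le add_pos_nonneg)
    qed
    also have "\<dots> \<le> (\<Prod>l\<le>N. 1 + (t - s) / (s + real l))"
      using assms by (intro sum_le_prod) auto
    also have "\<dots> = (\<Prod>l\<le>N. (t + real l) / (s + real l))"
    proof (rule prod.cong[OF refl])
      fix l
      have "s + real l > 0" using assms by simp
      then show "1 + (t - s) / (s + real l) = (t + real l) / (s + real l)"
        by (simp add: divide_simps)
    qed
    finally show ?thesis .
  qed
  have "filterlim (\<lambda>N. (t - s) / (s + 1) * harm (Suc N)) at_top sequentially"
    using assms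
    by (intro filterlim_tendsto_pos_mult_at_top[OF tendsto_const]
        filterlim_compose[OF harm_at_top filterlim_Suc]) auto
  then have "filterlim (\<lambda>N. \<Prod>l\<le>N. (t + real l) / (s + real l)) at_top sequentially"
    by (rule filterlim_at_top_mono) (intro always_eventually allI ge)
  from tendsto_inverse_0_at_top[OF this] show ?thesis
    by (simp add: prod_inversef [symmetric] del: prod_inversef)
qed

lemma prod_ratio_le_imp_le:
  fixes s t C :: real
  assumes "0 < s" "0 < C" and "\<And>j::nat. C \<le> (\<Prod>l\<le>j. (s + real l) / (t + real l))"
  shows "t \<le> s"
proof (rule ccontr)
  assume "\<not> t \<le> s"
  then have "(\<lambda>N. \<Prod>l\<le>N. (s + real l) / (t + real l)) \<longlonglongrightarrow> 0"
    using assms(1) by (intro prod_ratio_tendsto_0) auto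
  then have "C \<le> 0" by (rule LIMSEQ_le_const) (use assms(3) in auto)
  then show False using assms(2) by simp
qed

section \<open>Forward differences on the integers\<close>

interpretation unif: nodes real
  by unfold_locales (simp add: strict_mono_def)

text \<open>On consecutive integers the gaps divided by are 1, ..., j, with product j!.\<close>

lemma funpow_diff_seq: "(diff_seq ^^ j) u k = (-1) ^ j * fact j * unif.dd j u k"
proof (induction j arbitrary: k)
  case (Suc j)
  have "unif.dd j u k - unif.dd j u (Suc k) = real (Suc j) * unif.dd (Suc j) u k"
    using unif.dd_step[of j u k] by simp
  moreover have "(diff_seq ^^ Suc j) u k = (-1) ^ Suc j * fact j * (unif.dd j u k - unif.dd j u (Suc k))"
    by (simp add: diff_seq_def Suc.IH algebra_simps)
  ultimately show ?case by (simp del: unif.dd.simps)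
qed simp

lemma zero_le_fact_mult_iff: "0 \<le> fact j * (x::real) \<longleftrightarrow> 0 \<le> x"
  using mult_le_cancel_left_pos[of "fact j" 0 x] by simp

lemma completely_monotone_iff: "completely_monotone u \<longleftrightarrow> unif.cm u"
  unfolding completely_monotone_def unif.cm_def funpow_diff_seq
  by (simp add: zero_le_fact_mult_iff flip: mult.assoc power_mult_distrib)

lemma funpow_diff_net1: "(diff_net1 ^^ i) w m n = (diff_seq ^^ i) (\<lambda>m. w m n) m"
  by (induction i arbitrary: m) (simp_all add: diff_net1_def diff_seq_def)

lemma funpow_diff_net2: "(diff_net2 ^^ j) u m n = (diff_seq ^^ j) (u m) n"
  by (induction j arbitrary: n) (simp_all add: diff_net2_def diff_seq_def)

lemma joint_completely_monotone_iff:
  "joint_completely_monotone u \<longleftrightarrow> (\<forall>j n. unif.cm (\<lambda>m. unif.dd j (u m) n))"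
proof -
  have "(-1) ^ (i + j) * (diff_net1 ^^ i) ((diff_net2 ^^ j) u) m n
     = fact i * fact j * unif.dd i (\<lambda>m. unif.dd j (u m) n) m" for i j m n
  proof -
    have "(-1) ^ (i + j) * (diff_net1 ^^ i) ((diff_net2 ^^ j) u) m n
      = ((-1) ^ (i + j) * (-1) ^ i * (-1) ^ j) * (fact i * fact j * unif.dd i (\<lambda>m. unif.dd j (u m) n) m)"
      by (simp add: funpow_diff_net1 funpow_diff_net2 funpow_diff_seq unif.dd_cmult)
    also have "(-1) ^ (i + j) * (-1) ^ i * (-1) ^ j = (1::real)"
      by (simp add: power_add mult.commute mult.left_commute flip: power_mult_distrib)
    finally show ?thesis by simp
  qed
  then show ?thesis
    unfolding joint_completely_monotone_def unif.cm_def
    by (auto simp: zero_le_fact_mult_iff mult.assoc)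
qed

lemma dd_indicator_0: "unif.dd k (indicator {0}) i = (if i = 0 then 1 / fact k else 0)"
  by (induction k arbitrary: i) (auto simp: indicator_def)

text \<open>At 0, the divided difference of 1/(k+c) of order j+1 over that of the indicator is 1/c
  times a product of (1+l)/(1+c+l), which tends to 0. So a majorant C/(k+c) leaves no room for a
  point mass at 0.\<close>

lemma not_completely_monotone_drop_0:
  assumes "0 < c" "unif.cm (\<lambda>k. C * (1 / (real k + c)) - v k)" "0 < \<epsilon>"
  shows "\<not> completely_monotone (\<lambda>k. v k - \<epsilon> * indicator {0} k)"
proof
  assume "completely_monotone (\<lambda>k. v k - \<epsilon> * indicator {0} k)"
  then have "unif.cm (\<lambda>k. v k - \<epsilon> * indicator {0} k)"
    by (simp add: completely_monotone_iff)
  from unif.cm_add[OF assms(2) this] 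
  have cm: "unif.cm (\<lambda>k. C * (1 / (real k + c)) - \<epsilon> * indicator {0} k)" by simp
  have le: "\<epsilon> \<le> C / c * (\<Prod>l\<le>j. (1 + real l) / (1 + c + real l))" for j
  proof -
    let ?P = "\<Prod>l<Suc j. 1 + c + real l"
    have P: "?P > 0" using assms(1) by (intro prod_pos) auto
    have "0 \<le> C * unif.dd (Suc j) (\<lambda>k. 1 / (real k + c)) 0 - \<epsilon> * unif.dd (Suc j) (indicator {0}) 0"
      using cm unfolding unif.cm_def unif.dd_diff unif.dd_cmult by blast
    also have "unif.dd (Suc j) (\<lambda>k. 1 / (real k + c)) 0 = 1 / (\<Prod>l\<le>Suc j. real l + c)"
      using assms(1) by (subst unif.dd_inverse) (auto simp: add_nonneg_pos)
    also have "(\<Prod>l\<le>Suc j. real l + c) = c * ?P"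
      by (subst lessThan_Suc_atMost [symmetric], subst prod.lessThan_Suc_shift)
         (simp add: algebra_simps)
    also have "unif.dd (Suc j) (indicator {0}) 0 = 1 / fact (Suc j)"
      by (subst dd_indicator_0) simp
    also have "fact (Suc j) = (\<Prod>l<Suc j. 1 + real l)"
      by (simp only: fact_prod_Suc of_nat_prod atLeast0LessThan) simp
    finally have "\<epsilon> \<le> C / c * ((\<Prod>l<Suc j. 1 + real l) / ?P)"
      using P assms(1) prod_pos[of "{..<Suc j}" "\<lambda>l. 1 + real l"]
      by (simp add: divide_simps mult.commute del: prod.lessThan_Suc)
    then show ?thesis by (simp only: prod_dividef lessThan_Suc_atMost)
  qed
  have "(\<lambda>j. C / c * (\<Prod>l\<le>j. (1 + real l) / (1 + c + real l))) \<longlonglongrightarrow> C / c * 0"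
    using assms(1) by (intro tendsto_mult_left prod_ratio_tendsto_0) auto
  then have "\<epsilon> \<le> C / c * 0" by (rule LIMSEQ_le_const) (use le in auto)
  then show False using assms(3) by simp
qed

section \<open>Extrapolation to a node left of 0\<close>

lemma (in nodes) dd_shift:
  assumes "\<And>i. p (Suc i) = real i"
  shows "dd k v (Suc i) = unif.dd k (\<lambda>i. v (Suc i)) i"
  by (induction k arbitrary: i) (simp_all add: assms)

text \<open>The Newton terms over the integers are nonnegative and the first is \<open>v 1\<close>.
  The majorant C/(y+c) bounds the remainder by a product of (x+l)/(c+l), which vanishes as x <
  c.\<close>

lemma (in nodes) value_at_left_ge:
  assumes p: "p 0 = - x" "\<And>i. p (Suc i) = real i" and x: "0 < x" "x < c"
    and V: "dom v V" "cm (\<lambda>i. C * (1 / (p i + c)) - V i)"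
    and v: "unif.cm (\<lambda>i. v (Suc i))"
  shows "v 1 \<le> v 0"
proof -
  have c: "0 < p i + c" for i using p x by (cases i) auto
  have "v 1 - C / (c - x) * (\<Prod>l\<le>N. (x + real l) / (c + real l)) \<le> v 0" for N
  proof -
    let ?Q = "\<Prod>l\<le>N. x + real l" and ?R = "\<Prod>l\<le>N. c + real l"
    have Q: "?Q > 0" using x by (intro prod_pos) auto
    have dd: "0 \<le> dd k v 1" for k
      using v dd_shift[OF p(2), of k v 0] by (simp add: unif.cm_def)
    have "0 \<le> (\<Prod>l<k. p (Suc l) - p 0) * dd k v 1" for k
      using dd x by (intro mult_nonneg_nonneg prod_nonneg) (auto simp: p)
    then have "(\<Sum>k\<in>{0}. (\<Prod>l<k. p (Suc l) - p 0) * dd k v 1)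
        \<le> (\<Sum>k\<le>N. (\<Prod>l<k. p (Suc l) - p 0) * dd k v 1)"
      by (intro sum_mono2) auto
    then have 1: "v 1 + ?Q * dd (Suc N) v 0 \<le> v 0"
      using newton[of v N] by (simp add: p add.commute del: dd.simps(2) sum.atMost_Suc)
    have "\<bar>dd (Suc N) v 0\<bar> \<le> dd (Suc N) V 0" by (rule dom_dd[OF V(1)])
    also have "0 \<le> C * dd (Suc N) (\<lambda>i. 1 / (p i + c)) 0 - dd (Suc N) V 0"
      using V(2) unfolding cm_def dd_diff dd_cmult by blast
    then have "dd (Suc N) V 0 \<le> C * dd (Suc N) (\<lambda>i. 1 / (p i + c)) 0" by linarith
    also have "\<dots> = C * (1 / (\<Prod>l\<le>Suc N. p l + c))"
      by (subst dd_inverse[OF c]) simp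
    also have "(\<Prod>l\<le>Suc N. p l + c) = (c - x) * ?R"
      by (subst prod.atMost_Suc_shift) (simp add: p add.commute)
    finally have "?Q * \<bar>dd (Suc N) v 0\<bar> \<le> ?Q * (C * (1 / ((c - x) * ?R)))"
      using Q by (intro mult_left_mono) auto
    also have "\<dots> = C / (c - x) * (?Q / ?R)" by simp
    finally have 2: "?Q * \<bar>dd (Suc N) v 0\<bar> \<le> C / (c - x) * (\<Prod>l\<le>N. (x + real l) / (c + real l))"
      by (simp only: prod_dividef)
    have "- (?Q * \<bar>dd (Suc N) v 0\<bar>) \<le> ?Q * dd (Suc N) v 0"
      using Q by (subst mult_minus_right [symmetric], intro mult_left_mono) linarith+
    then show ?thesis using 1 2 by linarith
  qed
  moreover have "(\<lambda>N. v 1 - C / (c - x) * (\<Prod>l\<le>N. (x + real l) / (c + real l))) \<longlonglongrightarrow> v 1 - C / (c - x) * 0"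
    using x by (intro tendsto_intros prod_ratio_tendsto_0) auto
  ultimately show ?thesis
    using LIMSEQ_le_const2[of _ "v 1 - C / (c - x) * 0" "v 0"] by auto
qed

section \<open>The net of a quadratic pair\<close>

locale quadratic_pair =
  fixes a0 a1 a2 b0 b1 b2 :: real
  assumes pos: "a0 > 0" "a1 > 0" "a2 > 0" "b0 > 0" "b1 > 0" "b2 > 0"
    and a_le: "a1 \<le> a2" and b_le: "b1 \<le> b2"
begin

definition A :: "real \<Rightarrow> real" where "A y = a0 * (y + a1) * (y + a2)"
definition B :: "real \<Rightarrow> real" where "B y = b0 * (y + b1) * (y + b2)"
definition g :: "real \<Rightarrow> real" where "g y = B y / A y"

text \<open>The order j divided difference of the net in n (see \<open>dd_u\<close>), with m
  replaced by a real y so that it can also be evaluated at -x.\<close>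

definition kern :: "nat \<Rightarrow> nat \<Rightarrow> real \<Rightarrow> real" where
  "kern n j y = 1 / A y * (\<Prod>l\<le>j. 1 / (g y + real (n + l)))"

definition r :: real where "r = b0 / a0"
definition \<sigma> :: real where "\<sigma> = a1 + a2 - b1 - b2"
definition \<tau> :: real where "\<tau> = (a1 - b1) * (b2 - a1)"

lemma A_pos: "- a1 < y \<Longrightarrow> 0 < A y"
  unfolding A_def using pos a_le by simp

lemma g_pos: "0 \<le> y \<Longrightarrow> 0 < g y"
  unfolding g_def B_def using pos A_pos[of y] by simp

lemma r_pos: "0 < r" using pos by (simp add: r_def)

text \<open>Divide the linear polynomial (y+a1)(y+a2) - (y+b1)(y+b2) by y+a1: \<sigma> is its slope
  and \<tau> its value at -a1.\<close>

lemma g_eq: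
  assumes "- a1 < y"
  shows "g y = r - r * (\<sigma> * (1 / (y + a2)) + \<tau> * ((1 / (y + a1)) * (1 / (y + a2))))"
proof -
  have "y + a1 > 0" "y + a2 > 0" using assms a_le by auto
  then show ?thesis
    using pos unfolding g_def A_def B_def r_def \<sigma>_def \<tau>_def
    by (simp add: divide_simps) (simp add: algebra_simps)
qed

definition u :: "nat \<Rightarrow> nat \<Rightarrow> real" where
  "u m n = 1 / (B (real m) + A (real m) * real n)"

lemma u_eq: "u m n = 1 / A (real m) * (1 / (real n + g (real m)))"
  using A_pos[of "real m"] pos by (simp add: u_def g_def field_simps)

lemma dd_u: "unif.dd j (u m) n = kern n j (real m)"
proof -
  have "u m = (\<lambda>n. 1 / A (real m) * (1 / (real n + g (real m))))" by (simp add: u_eq fun_eq_iff)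
  then have "unif.dd j (u m) n = 1 / A (real m) * unif.dd j (\<lambda>n. 1 / (real n + g (real m))) n"
    by (simp only: unif.dd_cmult)
  also have "unif.dd j (\<lambda>n. 1 / (real n + g (real m))) n = 1 / (\<Prod>l\<le>j. real (n + l) + g (real m))"
    using g_pos[of "real m"] by (intro unif.dd_inverse) (auto simp: add_nonneg_pos)
  finally show ?thesis by (simp add: kern_def prod_dividef add.commute)
qed

lemma joint_iff: "joint_completely_monotone u \<longleftrightarrow> (\<forall>n j. unif.cm (\<lambda>m. kern n j (real m)))"
  unfolding joint_completely_monotone_iff dd_u by blast

section \<open>Sufficient condition and minimality\<close>

lemma joint_completely_monotone_u:
  assumes "0 \<le> \<sigma>" "0 \<le> \<tau>"
  shows "joint_completely_monotone u"
proof -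
  have cm_a: "unif.cm (\<lambda>m. 1 / (real m + a1))" "unif.cm (\<lambda>m. 1 / (real m + a2))"
    using pos by (auto intro!: unif.cm_inverse add_nonneg_pos)
  have "unif.cm (\<lambda>m. 1 / A (real m))"
    using unif.cm_cmult[OF _ unif.cm_mult[OF cm_a], of "1 / a0"] pos by (simp add: A_def mult.assoc)
  moreover have "unif.cm (\<lambda>m. 1 / (g (real m) + L))" if "0 \<le> L" for L
  proof -
    let ?h = "\<lambda>m. r * (\<sigma> * (1 / (real m + a2)) + \<tau> * ((1 / (real m + a1)) * (1 / (real m + a2))))"
    have g: "g (real m) + L = (L + r) - ?h m" for m
      using g_eq[of "real m"] pos by simp
    have h: "unif.cm ?h"
      by (rule unif.cm_cmult unif.cm_add unif.cm_mult assms cm_a less_imp_le r_pos)+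
    have lt: "?h m < L + r" for m
      using g[of m] g_pos[of "real m"] that by simp
    have "unif.dom (\<lambda>m. 1 / ((L + r) - ?h m)) (\<lambda>m. 1 / ((L + r) - ?h m))"
      by (rule unif.dom_geometric[OF unif.dom_self[OF h] lt]) (use that r_pos in simp)
    then show ?thesis unfolding g by (rule unif.dom_cm)
  qed
  ultimately show ?thesis
    unfolding joint_iff kern_def by (intro allI unif.cm_mult unif.cm_prod) auto
qed

lemma minimal_u:
  assumes "joint_completely_monotone u"
  shows "minimal_joint_completely_monotone u"
  unfolding minimal_joint_completely_monotone_def
proof (intro conjI allI impI assms)
  fix \<epsilon> :: real assume \<epsilon>: "0 < \<epsilon>"
  \<comment> \<open>A positive shift strictly below b1, hence below b2, as the two weighted bounds
    require.\<close>
  have c: "0 < real i + b1 / 2" for i using pos by simp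
  let ?K = "1 / (b2 - b1 / 2)"
  have "unif.wbound (b1 / 2) ?K (\<lambda>i. 1 / (real i + b2))"
    using pos b_le by (intro unif.wbound_inverse c) auto
  then have "unif.cm (\<lambda>i. ?K * (1 / (real i + b1 / 2)) - 1 / (real i + b2) * (1 / (real i + b1)))"
    using pos by (intro unif.wbound_mult_inverse c) auto
  from unif.cm_cmult[OF _ this, of "1 / b0"]
  have "unif.cm (\<lambda>k. 1 / b0 * (?K * (1 / (real k + b1 / 2)) - 1 / (real k + b2) * (1 / (real k + b1))))"
    using pos by simp
  then have "unif.cm (\<lambda>k. (1 / b0 * ?K) * (1 / (real k + b1 / 2)) - u k 0)"
    unfolding u_def B_def right_diff_distrib by (simp add: mult.commute mult.left_commute)
  from not_completely_monotone_drop_0[OF _ this \<epsilon>]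
  show "\<not> completely_monotone (\<lambda>k. u k 0 - \<epsilon> * indicator {0} k)" using pos by simp
  \<comment> \<open>The row m = 0 equals its majorant, so this difference is the zero
    sequence.\<close>
  have "unif.cm (\<lambda>k. 1 / A 0 * (1 / (real k + g 0)) - u 0 k)"
    unfolding u_eq by (simp add: unif.cm_const)
  from not_completely_monotone_drop_0[OF _ this \<epsilon>]
  show "\<not> completely_monotone (\<lambda>k. u 0 k - \<epsilon> * indicator {0} k)" using g_pos[of 0] by simp
qed

section \<open>Necessary inequalities\<close>

lemma g_le_of_kern_le:
  assumes "0 < g y + real n" "- a1 < y" "0 \<le> z" "\<And>j. kern n j z \<le> kern n j y"
  shows "g y \<le> g z"
proof -
  \<comment> \<open>The left side is independent of j, so the products stay away from 0. The offset
    n keeps the factors positive even where \<open>g y\<close> is negative.\<close>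
  have "A y / A z \<le> (\<Prod>l\<le>j. (g z + real n + real l) / (g y + real n + real l))" for j
  proof -
    let ?Y = "\<Prod>l\<le>j. g y + real n + real l" and ?Z = "\<Prod>l\<le>j. g z + real n + real l"
    have "?Y > 0" "?Z > 0"
      using assms(1) g_pos[OF assms(3)] by (auto intro!: prod_pos add_pos_nonneg)
    moreover have "0 < A y" "0 < A z" using A_pos assms(2,3) pos by auto
    moreover have "1 / A z * (1 / ?Z) \<le> 1 / A y * (1 / ?Y)"
      using assms(4)[of j] by (simp add: kern_def prod_dividef add.assoc)
    ultimately have "A y / A z \<le> ?Z / ?Y"
      by (simp add: divide_simps mult.commute)
    then show ?thesis by (simp only: prod_dividef)
  qed
  from prod_ratio_le_imp_le[OF _ _ this]
  show ?thesis using A_pos[of y] A_pos[of z] pos assms(2,3) g_pos[OF assms(3)] by simp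
qed

lemma g_mono_nat:
  assumes "joint_completely_monotone u"
  shows "g (real m) \<le> g (real (Suc m))"
proof (rule g_le_of_kern_le[where n = 0])
  show "- a1 < real m" using pos by simp
  fix j
  have "0 \<le> unif.dd 1 (\<lambda>m. kern 0 j (real m)) m"
    using assms unfolding joint_iff unif.cm_def by blast
  then show "kern 0 j (real (Suc m)) \<le> kern 0 j (real m)" by simp
qed (use g_pos[of "real m"] in auto)

lemma sum_le:
  assumes "joint_completely_monotone u"
  shows "b1 + b2 \<le> a1 + a2"
proof (rule ccontr)
  assume *: "\<not> ?thesis"
  have "incseq (\<lambda>m. g (real m))" using g_mono_nat[OF assms] by (rule incseq_SucI)
  moreover have "(\<lambda>m. g (real m)) \<longlonglongrightarrow> r - r * (\<sigma> * 0 + \<tau> * (0 * 0))"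
  proof (subst g_eq)
    show "- a1 < real m" for m using pos by simp
    have "(\<lambda>m. 1 / (real m + a)) \<longlonglongrightarrow> 0" for a :: real
      by (rule tendsto_divide_0[OF tendsto_const])
         (auto intro!: filterlim_at_top_imp_at_infinity filterlim_tendsto_add_at_top
           simp: add.commute[of _ a] filterlim_real_sequentially)
    then show "(\<lambda>m. r - r * (\<sigma> * (1 / (real m + a2)) + \<tau> * (1 / (real m + a1) * (1 / (real m + a2)))))
      \<longlonglongrightarrow> r - r * (\<sigma> * 0 + \<tau> * (0 * 0))"
      by (intro tendsto_intros)
  qed
  ultimately have le: "g (real m) \<le> r" for m
    using incseq_le by force
  \<comment> \<open>In B \<le> r A the quadratic terms cancel; a linear inequality with positive
    slope cannot hold for all m.\<close>
  have "real m * (b1 + b2 - a1 - a2) \<le> a1 * a2 - b1 * b2" for m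
  proof -
    have "B (real m) \<le> r * A (real m)"
      using le[of m] A_pos[of "real m"] pos by (simp add: g_def pos_divide_le_eq)
    then have "(real m + b1) * (real m + b2) \<le> (real m + a1) * (real m + a2)"
      using pos by (simp add: A_def B_def r_def mult.assoc)
    then show ?thesis by (simp add: algebra_simps)
  qed
  moreover obtain m where "(a1 * a2 - b1 * b2) < real m * (b1 + b2 - a1 - a2)"
    using reals_Archimedean3[of "b1 + b2 - a1 - a2"] * by auto
  ultimately show False by (meson not_le)
qed

lemma g_le_0:
  assumes u: "joint_completely_monotone u" and x: "0 < x" "x < a1"
  shows "g (- x) \<le> g 0"
proof -
  \<comment> \<open>Prepending -x to 0, 1, 2, ... makes \<open>p 1\<close> the point 0, so the
    comparison is between -x and 0.\<close>
  define p where "p i = (case i of 0 \<Rightarrow> - x | Suc k \<Rightarrow> real k)" for i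
  have p: "p 0 = - x" "\<And>i. p (Suc i) = real i" by (simp_all add: p_def)
  interpret nodes p
    by unfold_locales (use x in \<open>auto simp: strict_mono_Suc_iff p_def split: nat.split\<close>)
  \<comment> \<open>c > x makes the Newton remainder vanish; c < a1 lets 1/(y+a1) and 1/(y+a2) be
    bounded against the weight.\<close>
  obtain c where c: "x < c" "c < a1" using dense x by blast
  have pc: "0 < p i + c" for i using p x c by (cases i) auto
  have pa: "- a1 < p i" for i using pc[of i] c by linarith
  let ?h = "\<lambda>i. r * (\<sigma> * (1 / (p i + a2)) + \<tau> * ((1 / (p i + a1)) * (1 / (p i + a2))))"
  \<comment> \<open>Absolute values, since \<sigma> and \<tau> may be negative here.\<close>
  let ?H = "\<lambda>i. r * (\<bar>\<sigma>\<bar> * (1 / (p i + a2)) + \<bar>\<tau>\<bar> * ((1 / (p i + a1)) * (1 / (p i + a2))))"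
  have ca: "c < a1" "c < a2" using c a_le by auto
  have cm_a: "cm (\<lambda>i. 1 / (p i + a1))" "cm (\<lambda>i. 1 / (p i + a2))"
    using pc ca by (auto intro!: cm_inverse) (smt (verit))+
  have "dom ?h (\<lambda>i. \<bar>r\<bar> * (\<bar>\<sigma>\<bar> * (1 / (p i + a2)) + \<bar>\<tau>\<bar> * ((1 / (p i + a1)) * (1 / (p i + a2)))))"
    by (intro dom_cmult dom_add dom_mult dom_self cm_a)
  then have hH: "dom ?h ?H" using r_pos by simp
  have "\<exists>K. wbound c K ?H"
    by (rule exI, (rule wbound_mult wbound_add wbound_const wbound_inverse pc ca less_imp_le r_pos abs_ge_zero)+)
  then obtain K where K: "wbound c K ?H" ..
  \<comment> \<open>For n > K the geometric series converge at every node, -x included, and g + n is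
    positive there although g(-x) may not be.\<close>
  obtain n where n: "K < real n" using reals_Archimedean2 by blast
  have Hlt: "?H i < real (n + l) + r" for i l
    using wbound_le[OF K pc, of i] n r_pos by simp
  have g: "g (p i) + L = (L + r) - ?h i" for i L
    using g_eq[OF pa, of i] by simp
  have g_n: "0 < g (p i) + real n" for i
    using g[of i "real n"] dom_abs[OF hH, of i] Hlt[of i 0] by simp
  have "kern n j (p 1) \<le> kern n j (p 0)" for j
  proof -
    \<comment> \<open>Majorant of \<open>kern\<close> without its factor 1/(y+a1), which is reserved
      for the exchange with the weight.\<close>
    let ?V = "\<lambda>i. 1 / a0 * (1 / (p i + a2)) * (\<Prod>l\<le>j. 1 / ((real (n + l) + r) - ?H i))"
    have "\<exists>K. wbound c K ?V"
      by (rule exI, rule wbound_mult[OF wbound_mult[OF wbound_const wbound_inverse[OF pc ca(2)]]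
            wbound_prod[OF finite_atMost wbound_geometric[OF K _ pc]]])
         (use pos n r_pos in auto)
    then obtain K' where "wbound c K' ?V" ..
    from wbound_mult_inverse[OF this pc ca(1)]
    have cm: "cm (\<lambda>i. K' * (1 / (p i + c)) - ?V i * (1 / (p i + a1)))" .
    have "dom (\<lambda>i. 1 / a0 * (1 / (p i + a2)) * (\<Prod>l\<le>j. 1 / ((real (n + l) + r) - ?h i)) * (1 / (p i + a1)))
      (\<lambda>i. ?V i * (1 / (p i + a1)))"
    proof (intro dom_mult dom_prod dom_geometric[OF hH Hlt] dom_self cm_a)
      show "cm (\<lambda>i. 1 / a0)" using pos by (intro cm_const) auto
    qed (use r_pos in \<open>auto intro: add_nonneg_pos\<close>)
    moreover have "(\<lambda>i. 1 / a0 * (1 / (p i + a2)) * (\<Prod>l\<le>j. 1 / ((real (n + l) + r) - ?h i)) * (1 / (p i + a1)))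
       = (\<lambda>i. kern n j (p i))"
      unfolding g [symmetric] kern_def A_def by (simp add: fun_eq_iff)
    ultimately have dom: "dom (\<lambda>i. kern n j (p i)) (\<lambda>i. ?V i * (1 / (p i + a1)))" by simp
    show ?thesis
    proof (rule value_at_left_ge[OF p x(1) c(1) dom cm])
      show "unif.cm (\<lambda>i. kern n j (p (Suc i)))" using u unfolding joint_iff p by blast
    qed
  qed
  then show ?thesis
    using g_le_of_kern_le[of "- x" n 0] g_n[of 0] x p(1) p(2)[of 0] by simp
qed

lemma harmonic_le:
  assumes "joint_completely_monotone u"
  shows "1 / a1 + 1 / a2 \<le> 1 / b1 + 1 / b2"
proof -
  \<comment> \<open>The claim multiplied by a1 a2 b1 b2 is \<open>?d\<close> \<le> 0.\<close>
  let ?d = "(a1 + a2) * (b1 * b2) - (b1 + b2) * (a1 * a2)"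
  have le: "?d \<le> x * (b1 * b2 - a1 * a2)" if x: "0 < x" "x < a1" for x
  proof -
    have "B (- x) / A (- x) \<le> B 0 / A 0" using g_le_0[OF assms x] by (simp add: g_def)
    then have "B (- x) * A 0 \<le> B 0 * A (- x)"
      using A_pos[of "- x"] A_pos[of 0] x by (simp add: divide_simps mult.commute)
    \<comment> \<open>The constant terms agree, so a factor x cancels and the remaining bound
      vanishes with x.\<close>
    then have "(a0 * b0) * (x * ?d) \<le> (a0 * b0) * (x * (x * (b1 * b2 - a1 * a2)))"
      by (simp add: A_def B_def algebra_simps)
    then show ?thesis using pos x by simp
  qed
  have "((\<lambda>x. x * (b1 * b2 - a1 * a2)) \<longlongrightarrow> 0 * (b1 * b2 - a1 * a2)) (at_right 0)"
    by (intro tendsto_intros)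
  moreover have "eventually (\<lambda>x. ?d \<le> x * (b1 * b2 - a1 * a2)) (at_right 0)"
    using eventually_at_right_real[OF pos(2)] by eventually_elim (use le in auto)
  ultimately have "?d \<le> 0 * (b1 * b2 - a1 * a2)"
    by (rule tendsto_lowerbound) simp
  then show ?thesis using pos by (simp add: divide_simps) (simp add: algebra_simps)
qed

end

theorem theorem3p3:
  fixes a0 a1 a2 b0 b1 b2 :: real and a b :: "real \<Rightarrow> real"
  assumes "a0 > 0" "a1 > 0" "a2 > 0" "b0 > 0" "b1 > 0" "b2 > 0"
    and "\<And>x. x \<ge> 0 \<Longrightarrow> a x = a0 * (x + a1) * (x + a2)"
    and "\<And>x. x \<ge> 0 \<Longrightarrow> b x = b0 * (x + b1) * (x + b2)"
    and "a1 \<le> a2" "b1 \<le> b2"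
  shows "((b1 \<le> a1 \<and> a1 \<le> b2 \<or> b1 \<le> a2 \<and> a2 \<le> b2) \<and> b1 + b2 \<le> a1 + a2 \<longrightarrow>
           minimal_joint_completely_monotone (\<lambda>m n. 1 / (b (real m) + a (real m) * real n))) \<and>
         (joint_completely_monotone (\<lambda>m n. 1 / (b (real m) + a (real m) * real n)) \<longrightarrow>
           1 / a1 + 1 / a2 \<le> 1 / b1 + 1 / b2 \<and> b1 + b2 \<le> a1 + a2)"
proof -
  interpret quadratic_pair a0 a1 a2 b0 b1 b2
    using assms by unfold_locales
  have u: "(\<lambda>m n. 1 / (b (real m) + a (real m) * real n)) = u"
    by (simp add: fun_eq_iff u_def A_def B_def assms(7,8))
  show ?thesis unfolding u
  proof (intro conjI impI)
    assume *: "(b1 \<le> a1 \<and> a1 \<le> b2 \<or> b1 \<le> a2 \<and> a2 \<le> b2) \<and> b1 + b2 \<le> a1 + a2"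
    \<comment> \<open>If b1 \<le> a2 \<le> b2, then a1 \<le> a2 \<le> b2, and b1 + b2 \<le> a1 + a2
      \<le> a1 + b2 gives b1 \<le> a1.\<close>
    then have "b1 \<le> a1" "a1 \<le> b2" using a_le by auto
    then show "minimal_joint_completely_monotone u"
      using * by (intro minimal_u joint_completely_monotone_u) (auto simp: \<sigma>_def \<tau>_def)
  qed (use harmonic_le sum_le in auto)
qed

end
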